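(* Let $\Omega \subset \mathbb{R}^n$ be a domain, $N := \dim \mathbb{P}_d(\Omega)$, and let $\{K_i\}_{i=1}^N$ be a collection of compact sets contained in $\Omega$ which is unisolvent for $\mathbb{P}_d(\Omega)$, with Lebesgue constant $\Lambda_d$. Let $\varphi : \Omega \to \widehat{\Omega} := \varphi(\Omega)$ be an affine transformation $\varphi(x) = Ax + b$ such that $\det A \neq 0$. Let $$\Lambda_d^{\varphi} := \sup_{\widehat{K} \subset \widehat{\Omega}} \frac{1}{\mu(\widehat{K})} \sum_{i=1}^N \mu(\varphi(K_i)) \left| \int_{\widehat{K}} \ell_{\varphi(K_i)}(x)\,dx \right|$$ be the Lebesgue constant associated with $\{\varphi(K_i)\}_{i=1}^N$ in $\widehat{\Omega}$. Then $$\Lambda_d = \Lambda_d^{\varphi}.$$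
   Context: $\mathbb{P}_d(\Omega)$ is the space of (restrictions to $\Omega$ of) real polynomials in $n$ variables of total degree at most $d$; $\mu$ is Lebesgue measure. Throughout, "compact set" means the closure $K$ of an open connected set $U \subset \mathbb{R}^n$ with $0 < \mu(K) = \mu(U) < +\infty$. A collection $\{K_1,\dots,K_N\}$ is unisolvent for $\mathbb{P}_d(\Omega)$ if $p \in \mathbb{P}_d(\Omega)$ and $\int_{K_i} p(x)\,dx = 0$ for all $i$ imply $p=0$. The Lagrange basis $\{\ell_{K_i}\}_{i=1}^N$ of $\mathbb{P}_d(\Omega)$ associated with a unisolvent collection is the unique basis with $\int_{K_i} \ell_{K_j}(x)\,dx = \delta_{i,j}$; $\{\ell_{\varphi(K_i)}\}_{i=1}^N$ is likewise the Lagrange basis of $\mathbb{P}_d(\widehat{\Omega})$ associated with $\{\varphi(K_i)\}_{i=1}^N$. The Lebesgue constant is $$\Lambda_d := \sup_{K \subset \Omega} \frac{1}{\mu(K)} \sum_{i=1}^N \mu(K_i) \left| \int_K \ell_{K_i}(x)\,dx \right|,$$ where $K$ ranges over compact sets contained in $\Omega$ that are closures of open connected sets $U$ with $0 < \mu(K) = \mu(U) < +\infty$ (and $\widehat K$ over compact sets of the same kind contained in $\widehat\Omega$). *)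

theory Defs
  imports "HOL-Analysis.Analysis" "HOL-Library.Function_Algebras"
begin

text \<open>
  Functions on \<open>\<Omega>\<close> are represented by functions on the whole space that vanish outside \<open>\<Omega>\<close>,
  so that equality of functions on \<open>\<Omega>\<close> is equality in HOL. Since \<^class>\<open>real_vector\<close> has no
  instance for functions, the pointwise structure is supplied by interpreting \<^locale>\<open>vector_space\<close>.
\<close>

definition fun_scale :: "real \<Rightarrow> ('a \<Rightarrow> real) \<Rightarrow> 'a \<Rightarrow> real"
  where "fun_scale c f = (\<lambda>x. c * f x)"

global_interpretation fun_vs: vector_space "fun_scale :: real \<Rightarrow> ('a \<Rightarrow> real) \<Rightarrow> 'a \<Rightarrow> real"
  by unfold_locales (auto simp: fun_scale_def fun_eq_iff algebra_simps)

text \<open>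
  Real polynomials in \<open>CARD('n)\<close> variables, as functions; a multi-index is a map \<open>\<alpha> :: 'n \<Rightarrow> nat\<close>
  and its total degree is the sum of its values.
\<close>

definition multi_indices :: "nat \<Rightarrow> ('n::finite \<Rightarrow> nat) set"
  where "multi_indices d = {\<alpha>. (\<Sum>i\<in>UNIV. \<alpha> i) \<le> d}"

definition poly_eval :: "nat \<Rightarrow> (('n::finite \<Rightarrow> nat) \<Rightarrow> real) \<Rightarrow> real ^ 'n \<Rightarrow> real"
  where "poly_eval d c x = (\<Sum>\<alpha>\<in>multi_indices d. c \<alpha> * (\<Prod>i\<in>UNIV. (x $ i) ^ \<alpha> i))"

lemma finite_multi_indices: "finite (multi_indices d :: ('n::finite \<Rightarrow> nat) set)"
proof -
  have "\<alpha> i \<le> d" if "\<alpha> \<in> multi_indices d" for \<alpha> :: "'n \<Rightarrow> nat" and i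
    using that member_le_sum[of i UNIV \<alpha>] by (auto simp: multi_indices_def)
  then have "(multi_indices d :: ('n \<Rightarrow> nat) set) \<subseteq> PiE UNIV (\<lambda>_. {..d})"
    by auto
  then show ?thesis
    by (rule finite_subset) (simp add: finite_PiE)
qed

definition poly_space :: "nat \<Rightarrow> (real ^ 'n) set \<Rightarrow> (real ^ 'n \<Rightarrow> real) set"
  where "poly_space d \<Omega> = {\<lambda>x. if x \<in> \<Omega> then poly_eval d c x else 0 | c. True}"

definition compact_body :: "(real ^ 'n) set \<Rightarrow> bool"
  where "compact_body K \<longleftrightarrow> compact K \<and>
    (\<exists>U. open U \<and> connected U \<and> K = closure U \<and>
         0 < emeasure lebesgue K \<and> emeasure lebesgue K = emeasure lebesgue U \<and>
         emeasure lebesgue U < \<infinity>)"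

definition unisolvent :: "nat \<Rightarrow> (real ^ 'n) set \<Rightarrow> nat \<Rightarrow> (nat \<Rightarrow> (real ^ 'n) set) \<Rightarrow> bool"
  where "unisolvent d \<Omega> N K \<longleftrightarrow>
    (\<forall>p\<in>poly_space d \<Omega>. (\<forall>i\<in>{1..N}. (LINT x:K i|lebesgue. p x) = 0) \<longrightarrow> p = 0)"

definition is_lagrange_basis ::
    "nat \<Rightarrow> (real ^ 'n) set \<Rightarrow> nat \<Rightarrow> (nat \<Rightarrow> (real ^ 'n) set) \<Rightarrow> (nat \<Rightarrow> real ^ 'n \<Rightarrow> real) \<Rightarrow> bool"
  where "is_lagrange_basis d \<Omega> N K l \<longleftrightarrow>
    inj_on l {1..N} \<and> fun_vs.independent (l ` {1..N}) \<and> fun_vs.span (l ` {1..N}) = poly_space d \<Omega> \<and>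
    (\<forall>i\<in>{1..N}. \<forall>j\<in>{1..N}. (LINT x:K i|lebesgue. l j x) = (if i = j then 1 else 0))"

text \<open>Extensionality pins down the values at the irrelevant indices, which makes the family unique.\<close>

definition lagrange_basis ::
    "nat \<Rightarrow> (real ^ 'n) set \<Rightarrow> nat \<Rightarrow> (nat \<Rightarrow> (real ^ 'n) set) \<Rightarrow> nat \<Rightarrow> real ^ 'n \<Rightarrow> real"
  where "lagrange_basis d \<Omega> N K = (THE l. l \<in> extensional {1..N} \<and> is_lagrange_basis d \<Omega> N K l)"

text \<open>
  The supremum is taken in the extended reals: it can be infinite, for instance if \<open>\<Omega>\<close> is
  unbounded and \<open>d > 0\<close>.
\<close>

definition lebesgue_constant ::
    "nat \<Rightarrow> (real ^ 'n) set \<Rightarrow> nat \<Rightarrow> (nat \<Rightarrow> (real ^ 'n) set) \<Rightarrow> ereal"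
  where "lebesgue_constant d \<Omega> N K =
    (SUP C\<in>{C. compact_body C \<and> C \<subseteq> \<Omega>}.
       ereal (1 / measure lebesgue C *
         (\<Sum>i=1..N. measure lebesgue (K i) * \<bar>LINT x:C|lebesgue. lagrange_basis d \<Omega> N K i x\<bar>)))"

end

theory Submission
  imports Defs
begin

text \<open>
  An affine bijection \<open>g\<close> multiplies Lebesgue measure by a constant \<open>c > 0\<close>. Hence
  \<open>T f = (f \<circ> g\<inverse>) / c\<close> maps polynomials of degree at most \<open>d\<close> on \<open>\<Omega>\<close> bijectively onto those on
  \<open>g ` \<Omega>\<close> and satisfies \<open>\<integral> T f = \<integral> f\<close>, the first integral over \<open>g ` C\<close> and the second over \<open>C\<close>.
  So \<open>T\<close> carries the Lagrange basis to the Lagrange basis, and the factors \<open>c\<close> of \<open>\<mu>(g ` C)\<close> and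
  \<open>\<mu>(g ` K\<^sub>i)\<close> cancel in the Lebesgue constant. Nothing depends on the value \<open>c = \<bar>det A\<bar>\<close>.
\<close>

section \<open>Affine changes of variables\<close>

text \<open>
  Both sides equal the double integral of \<open>1\<^sub>E(x) 1\<^sub>B(x + y)\<close>, evaluated in the two orders of
  integration.
\<close>

lemma emeasure_mult_translation_invariant:
  fixes M :: "'a::euclidean_space measure"
  assumes sets_M: "sets M = sets borel"
    and fin: "sigma_finite_measure M"
    and inv: "\<And>v. distr M borel ((+) v) = M"
    and E: "E \<in> sets borel" and sym: "\<And>x. - x \<in> E \<longleftrightarrow> x \<in> E" and B: "B \<in> sets borel"
  shows "emeasure lborel E * emeasure M B = emeasure lborel B * emeasure M E"
proof -
  interpret M: sigma_finite_measure M by (rule fin)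
  interpret pair_sigma_finite M lborel ..
  have sets_M' [measurable_cong]: "sets M = sets borel" by (rule sets_M)
  note E [measurable] B [measurable]
  have space_M: "space M = UNIV" using sets_eq_imp_space_eq[OF sets_M] by simp
  have shift: "(\<integral>\<^sup>+ y. indicator S (v + y) \<partial>M) = emeasure M S" if [measurable]: "S \<in> sets borel" for S v
  proof -
    have "emeasure M S = (\<integral>\<^sup>+ y. indicator S y \<partial>distr M borel ((+) v))"
      using sets_M by (simp add: inv)
    also have "\<dots> = (\<integral>\<^sup>+ y. indicator S (v + y) \<partial>M)"
      by (subst nn_integral_distr) simp_all
    finally show ?thesis by simp
  qed
  have shift_lborel: "(\<integral>\<^sup>+ x. f x \<partial>lborel) = (\<integral>\<^sup>+ x. f (x - v) \<partial>lborel)"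
    if [measurable]: "f \<in> borel_measurable borel" for f :: "'a \<Rightarrow> ennreal" and v
  proof -
    have "(\<integral>\<^sup>+ x. f x \<partial>lborel) = (\<integral>\<^sup>+ x. f x \<partial>distr lborel borel ((+) (- v)))"
      by (simp add: lborel_distr_plus)
    also have "\<dots> = (\<integral>\<^sup>+ x. f (x - v) \<partial>lborel)"
      by (subst nn_integral_distr) simp_all
    finally show ?thesis .
  qed
  have "emeasure lborel E * emeasure M B = (\<integral>\<^sup>+ x. indicator E x * emeasure M B \<partial>lborel)"
    by (simp add: nn_integral_multc)
  also have "\<dots> = (\<integral>\<^sup>+ x. \<integral>\<^sup>+ y. indicator E x * indicator B (x + y) \<partial>M \<partial>lborel)"
    by (simp add: nn_integral_cmult shift)
  also have "\<dots> = (\<integral>\<^sup>+ y. \<integral>\<^sup>+ x. indicator E x * indicator B (x + y) \<partial>lborel \<partial>M)"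
    by (rule Fubini') measurable
  also have "\<dots> = (\<integral>\<^sup>+ y. \<integral>\<^sup>+ x. indicator E (x - y) * indicator B x \<partial>lborel \<partial>M)"
  proof (rule nn_integral_cong)
    \<comment> \<open>Replacing x by x - y, for fixed y, moves the dependence on y from the factor
      of \<open>B\<close> to the factor of \<open>E\<close>.\<close>
    fix y
    show "(\<integral>\<^sup>+ x. indicator E x * indicator B (x + y) \<partial>lborel)
      = (\<integral>\<^sup>+ x. indicator E (x - y) * indicator B x \<partial>lborel)"
      using shift_lborel[of "\<lambda>x. indicator E x * indicator B (x + y)" y] by simp
  qed
  also have "\<dots> = (\<integral>\<^sup>+ x. \<integral>\<^sup>+ y. indicator E (x - y) * indicator B x \<partial>M \<partial>lborel)"
    by (rule Fubini'[symmetric]) measurable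
  also have "\<dots> = (\<integral>\<^sup>+ x. \<integral>\<^sup>+ y. indicator E (- x + y) * indicator B x \<partial>M \<partial>lborel)"
  proof -
    \<comment> \<open>Symmetry of \<open>E\<close> flips the sign of the argument, so that y is
      merely translated by - x and the invariance of \<open>M\<close> applies to the inner
      integral.\<close>
    have "indicator E (x - y) = (indicator E (- x + y) :: ennreal)" for x y :: 'a
      using sym[of "x - y"] by (auto simp: indicator_def)
    then show ?thesis by simp
  qed
  also have "\<dots> = (\<integral>\<^sup>+ x. emeasure M E * indicator B x \<partial>lborel)"
  proof -
    have "(\<integral>\<^sup>+ y. indicator E (y - x) \<partial>M) = emeasure M E" for x
      using shift[OF E, of "- x"] by simp
    then show ?thesis by (simp add: nn_integral_multc)
  qed
  also have "\<dots> = emeasure lborel B * emeasure M E"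
    by (simp add: nn_integral_cmult mult.commute[of _ "emeasure M E"] mult.commute[of "emeasure lborel B"])
  finally show ?thesis .
qed

text \<open>In the preceding identity take \<open>E\<close> to be the unit ball, which is symmetric
  and of positive finite Lebesgue measure, and divide by that measure. Finiteness on balls makes
  \<open>M\<close> sigma-finite.\<close>

lemma translation_invariant_eq_density_lborel:
  fixes M :: "'a::euclidean_space measure"
  assumes sets_M: "sets M = sets borel"
    and fin: "\<And>r. emeasure M (ball 0 r) < \<infinity>"
    and inv: "\<And>v. distr M borel ((+) v) = M"
  shows "M = density lborel (\<lambda>_. emeasure M (ball 0 1) / emeasure lborel (ball 0 1 :: 'a set))"
proof (rule measure_eqI)
  have "sigma_finite_measure M"
  proof
    have "space M = UNIV" using sets_eq_imp_space_eq[OF sets_M] by simp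
    moreover have "(\<Union>n::nat. ball 0 (real n)) = (UNIV :: 'a set)"
      using reals_Archimedean2 by auto
    ultimately show "\<exists>A. countable A \<and> A \<subseteq> sets M \<and> \<Union>A = space M \<and> (\<forall>a\<in>A. emeasure M a \<noteq> \<infinity>)"
      using fin by (intro exI[of _ "range (\<lambda>n::nat. ball 0 (real n))"]) (auto simp: sets_M less_top)
  qed
  fix B assume "B \<in> sets M"
  then have B: "B \<in> sets borel" by (simp add: sets_M)
  let ?E = "ball 0 1 :: 'a set"
  have eq: "emeasure lborel ?E * emeasure M B = emeasure lborel B * emeasure M ?E"
    using \<open>sigma_finite_measure M\<close> B by (intro emeasure_mult_translation_invariant sets_M inv) auto
  have "emeasure lborel ?E \<noteq> 0" "emeasure lborel ?E \<noteq> \<infinity>"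
    using emeasure_lborel_ball_finite[of "0::'a" 1]
    by (auto simp: emeasure_ball[of 1 "0::'a"] unit_ball_vol_pos less_imp_neq[symmetric] ennreal_eq_0_iff not_le)
  then have "emeasure M B = emeasure lborel ?E * emeasure M B / emeasure lborel ?E"
    by (simp add: ennreal_mult_divide_eq mult.commute less_top)
  also have "\<dots> = emeasure lborel B * emeasure M ?E / emeasure lborel ?E" by (simp add: eq)
  also have "\<dots> = emeasure (density lborel (\<lambda>_. emeasure M ?E / emeasure lborel ?E)) B"
    using B by (simp add: emeasure_density_const ennreal_times_divide mult.commute)
  finally show "emeasure M B = emeasure (density lborel (\<lambda>_. emeasure M ?E / emeasure lborel ?E)) B" .
qed (simp add: sets_M)

text \<open>
  The change of variables theorems of HOL-Analysis require an index type of class \<^class>\<open>wellorder\<close>;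
  uniqueness of translation-invariant measures covers every finite index type.
\<close>

lemma distr_lborel_affine:
  fixes A A' :: "real ^ 'n ^ 'n" and b :: "real ^ 'n"
  assumes AA': "A ** A' = mat 1"
  obtains c :: real where "0 < c" "distr lborel borel (\<lambda>x. A *v x + b) = density lborel (\<lambda>_. ennreal c)"
proof -
  let ?g = "\<lambda>x. A *v x + b"
  let ?M = "distr lborel borel ?g"
  have A'A: "A' ** A = mat 1" using AA' by (simp add: matrix_left_right_inverse)
  have g [measurable]: "?g \<in> borel_measurable borel"
    by (intro borel_measurable_continuous_onI continuous_intros)
  \<comment> \<open>Translating by \<open>v\<close> after the affine map is the same as translating
    by \<open>A' *v v\<close> before it, and Lebesgue measure absorbs the latter.\<close>
  have inv: "distr ?M borel ((+) v) = ?M" for v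
  proof -
    have "distr ?M borel ((+) v) = distr lborel borel (\<lambda>x. v + ?g x)"
      by (simp add: distr_distr o_def)
    also have "(\<lambda>x. v + ?g x) = (\<lambda>x. ?g (A' *v v + x))"
      by (simp add: matrix_vector_right_distrib matrix_vector_mul_assoc AA' add.assoc)
    also have "distr lborel borel \<dots> = distr (distr lborel borel ((+) (A' *v v))) borel ?g"
      by (simp add: distr_distr o_def)
    finally show ?thesis by (simp add: lborel_distr_plus)
  qed
  \<comment> \<open>Preimages are images under the continuous inverse, hence preimages of balls are
    bounded and have finite measure.\<close>
  have pre: "?g -` S = (\<lambda>y. A' *v (y - b)) ` S" for S
  proof safe
    fix x assume "?g x \<in> S"
    then show "x \<in> (\<lambda>y. A' *v (y - b)) ` S"
      by (intro image_eqI[of _ _ "?g x"]) (simp_all add: matrix_vector_mul_assoc A'A)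
  qed (simp add: matrix_vector_mul_assoc AA')
  have ball: "emeasure ?M (ball 0 r) = emeasure lborel (?g -` ball 0 r)" for r
    by (simp add: emeasure_distr)
  have fin: "emeasure ?M (ball 0 r) < \<infinity>" for r
  proof -
    have "bounded ((\<lambda>y. A' *v (y - b)) ` cball 0 r)"
      unfolding matrix_vector_mult_diff_distrib
      by (intro compact_imp_bounded compact_continuous_image continuous_intros) simp
    then have "bounded (?g -` ball 0 r)"
      unfolding pre by (rule bounded_subset) auto
    then show ?thesis
      unfolding ball by (rule emeasure_bounded_finite)
  qed
  have "open (?g -` ball 0 1)"
    by (intro open_vimage continuous_intros) simp
  \<comment> \<open>This point is mapped to 0, so the preimage of the unit ball is a nonempty open
    set and is not a null set.\<close>
  moreover have "A' *v (0 - b) \<in> ?g -` ball 0 1"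
    by (simp add: matrix_vector_mul_assoc AA')
  ultimately have pos: "emeasure ?M (ball 0 1) \<noteq> 0"
    unfolding ball
    by (metis empty_iff open_not_negligible negligible_iff_null_sets null_setsI null_sets_completionI
        sets_lborel borel_open)
  define k where "k = emeasure ?M (ball 0 1) / emeasure lborel (ball 0 1 :: (real^'n) set)"
  have k: "?M = density lborel (\<lambda>_. k)"
    unfolding k_def by (rule translation_invariant_eq_density_lborel[OF _ fin inv]) simp
  have fin1: "emeasure lborel (ball 0 1 :: (real^'n) set) < \<infinity>"
    by (rule emeasure_lborel_ball_finite)
  have eq: "emeasure ?M (ball 0 1) = k * emeasure lborel (ball 0 1 :: (real^'n) set)"
    by (subst k) (simp add: emeasure_density_const)
  have "k \<noteq> 0" using pos eq by auto
  \<comment> \<open>An infinite density would force the unit ball to be Lebesgue null, because its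
    measure under \<open>?M\<close> is finite; \<open>eq\<close> would then contradict
    \<open>pos\<close>.\<close>
  moreover have "k \<noteq> \<infinity>"
  proof
    assume "k = \<infinity>"
    with eq fin[of 1] have "emeasure lborel (ball 0 1 :: (real^'n) set) = 0"
      by (auto simp: ennreal_top_mult split: if_splits)
    with eq pos show False by simp
  qed
  ultimately have "0 < enn2real k" "ennreal (enn2real k) = k"
    by (auto simp: enn2real_positive_iff less_top zero_less_iff_neq_zero)
  with k that show thesis by metis
qed

text \<open>The image of a set under \<open>g\<close> is its preimage under the inverse
  \<open>h\<close>, so \<open>distr_lborel_affine\<close> is applied to \<open>h\<close>, with
  \<open>A'\<close> in the role of the matrix. One constant serves measures and integrals
  alike.\<close>

lemma affine_change_of_variables:
  fixes A A' :: "real ^ 'n ^ 'n" and b :: "real ^ 'n"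
  defines "g \<equiv> \<lambda>x. A *v x + b"
  assumes AA': "A ** A' = mat 1"
  obtains c :: real where "0 < c"
    "\<And>C. C \<in> sets borel \<Longrightarrow> emeasure lebesgue (g ` C) = ennreal c * emeasure lebesgue C"
    "\<And>C f. compact C \<Longrightarrow> continuous_on C (\<lambda>x. f (g x)) \<Longrightarrow>
      (LINT y:g ` C|lebesgue. f y) = c * (LINT x:C|lebesgue. f (g x))"
proof -
  define h where "h = (\<lambda>y. A' *v y + - (A' *v b))"
  have A'A: "A' ** A = mat 1" using AA' by (simp add: matrix_left_right_inverse)
  have hg: "h (g x) = x" and gh: "g (h x) = x" for x
    by (simp_all add: g_def h_def matrix_vector_right_distrib matrix_vector_mult_diff_distrib
        matrix_vector_mul_assoc A'A AA')
  have image: "g ` S = h -` S" for S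
    by (auto simp: hg) (metis gh image_eqI)
  obtain c where c: "0 < c" and distr: "distr lborel borel h = density lborel (\<lambda>_. ennreal c)"
    unfolding h_def by (rule distr_lborel_affine[OF A'A])
  have h [measurable]: "h \<in> borel_measurable borel"
    unfolding h_def by (intro borel_measurable_continuous_onI continuous_intros)
  show thesis
  proof (rule that[OF c])
    fix C :: "(real ^ 'n) set" assume C [measurable]: "C \<in> sets borel"
    have "emeasure lebesgue (g ` C) = emeasure lborel (h -` C)"
      unfolding image using measurable_sets_borel[OF h C] by simp
    also have "\<dots> = emeasure (distr lborel borel h) C"
      by (simp add: emeasure_distr)
    also have "\<dots> = ennreal c * emeasure lebesgue C"
      by (simp add: distr emeasure_density_const)
    finally show "emeasure lebesgue (g ` C) = ennreal c * emeasure lebesgue C" .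
  next
    fix C :: "(real ^ 'n) set" and f :: "real ^ 'n \<Rightarrow> real"
    assume C: "compact C" and f: "continuous_on C (\<lambda>x. f (g x))"
    \<comment> \<open>Extending by 0 outside \<open>C\<close> turns a function continuous only on
      \<open>C\<close> into a Borel function on the whole space, so integrals over
      \<open>lebesgue\<close> can be computed over \<open>lborel\<close>.\<close>
    define F where "F = (\<lambda>x. indicator C x *\<^sub>R f (g x))"
    have F [measurable]: "F \<in> borel_measurable borel"
      unfolding F_def using C f
      by (intro borel_measurable_continuous_on_indicator) (auto intro: borel_compact)
    have "(LINT y:g ` C|lebesgue. f y) = (LINT y|lebesgue. F (h y))"
      unfolding set_lebesgue_integral_def image F_def
      by (intro Bochner_Integration.integral_cong) (auto simp: indicator_def gh)
    also have "\<dots> = (LINT y|lborel. F (h y))"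
      by (rule integral_completion) measurable
    also have "\<dots> = (LINT x|distr lborel borel h. F x)"
      by (subst integral_distr) simp_all
    also have "\<dots> = c * (LINT x|lborel. F x)"
      using c by (simp add: distr integral_density)
    also have "(LINT x|lborel. F x) = (LINT x|lebesgue. F x)"
      by (rule integral_completion[symmetric]) measurable
    finally show "(LINT y:g ` C|lebesgue. f y) = c * (LINT x:C|lebesgue. f (g x))"
      by (simp add: F_def set_lebesgue_integral_def)
  qed
qed

text \<open>The map is a homeomorphism and scales measure by one factor in (0, \<infinity>), so the
  image of the witness \<open>U\<close> is a witness for the image of \<open>K\<close>.\<close>

lemma compact_body_affine_image:
  fixes A A' :: "real ^ 'n ^ 'n" and b :: "real ^ 'n"
  assumes AA': "A ** A' = mat 1" and K: "compact_body K"
  shows "compact_body ((\<lambda>x. A *v x + b) ` K)"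
proof -
  define g where "g = (\<lambda>x. A *v x + b)"
  define h where "h = (\<lambda>y. A' *v y + - (A' *v b))"
  have A'A: "A' ** A = mat 1" using AA' by (simp add: matrix_left_right_inverse)
  have hg: "h (g x) = x" and gh: "g (h x) = x" for x
    by (simp_all add: g_def h_def matrix_vector_right_distrib matrix_vector_mult_diff_distrib
        matrix_vector_mul_assoc A'A AA')
  have image: "g ` S = h -` S" for S
    by (auto simp: hg) (metis gh image_eqI)
  have cont: "continuous_on S g" "continuous_on S h" for S
    unfolding g_def h_def by (intro continuous_intros)+
  obtain c where c: "0 < c"
    and scale: "\<And>C. C \<in> sets borel \<Longrightarrow> emeasure lebesgue (g ` C) = ennreal c * emeasure lebesgue C"
    unfolding g_def by (rule affine_change_of_variables[OF AA', of b]) blast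
  obtain U where U: "open U" "connected U" "K = closure U" "0 < emeasure lebesgue K"
    "emeasure lebesgue K = emeasure lebesgue U" "emeasure lebesgue U < \<infinity>" and "compact K"
    using K unfolding compact_body_def by blast
  have "compact (g ` K)"
    using \<open>compact K\<close> by (intro compact_continuous_image cont)
  moreover have "open (g ` U)"
    unfolding image
    using U(1) cont(2)[of UNIV] by (intro open_vimage)
  moreover have "connected (g ` U)"
    using U(2) cont by (intro connected_continuous_image)
  \<comment> \<open>One inclusion is continuity of \<open>g\<close>; the other holds because the
    compact image of \<open>K\<close> is closed.\<close>
  moreover have "g ` K = closure (g ` U)"
  proof
    show "g ` K \<subseteq> closure (g ` U)"
      unfolding U(3) by (intro image_closure_subset cont closed_closure closure_subset)
    show "closure (g ` U) \<subseteq> g ` K"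
    proof (rule closure_minimal)
      show "g ` U \<subseteq> g ` K" unfolding U(3) by (intro image_mono closure_subset)
      show "closed (g ` K)" using \<open>compact (g ` K)\<close> by (rule compact_imp_closed)
    qed
  qed
  moreover have "emeasure lebesgue (g ` K) = ennreal c * emeasure lebesgue K"
    using \<open>compact K\<close> by (intro scale borel_compact)
  moreover have "emeasure lebesgue (g ` U) = ennreal c * emeasure lebesgue U"
    using U(1) by (intro scale) simp
  moreover have "0 < ennreal c * emeasure lebesgue K"
    using c U(4) by (simp add: ennreal_zero_less_mult_iff)
  moreover have "ennreal c * emeasure lebesgue U < \<infinity>"
    using U(6) by (simp add: ennreal_mult_less_top)
  ultimately show ?thesis
    unfolding compact_body_def g_def[symmetric] U(5) by metis
qed

section \<open>Polynomial functions of bounded degree\<close>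

lemma poly_eval_add: "poly_eval d c x + poly_eval d c' x = poly_eval d (\<lambda>\<alpha>. c \<alpha> + c' \<alpha>) x"
  by (simp add: poly_eval_def algebra_simps sum.distrib)

lemma poly_eval_scale: "k * poly_eval d c x = poly_eval d (\<lambda>\<alpha>. k * c \<alpha>) x"
  by (simp add: poly_eval_def sum_distrib_left mult.assoc)

lemma continuous_on_poly_eval: "continuous_on S (poly_eval d c)"
  unfolding poly_eval_def by (intro continuous_intros)

text \<open>Polynomials of degree at most \<open>d\<close> are handled as members of
  \<open>range (poly_eval d)\<close>, so that later closure arguments can avoid explicit
  coefficients.\<close>

lemma range_poly_eval_add:
  "f \<in> range (poly_eval d) \<Longrightarrow> f' \<in> range (poly_eval d) \<Longrightarrow> (\<lambda>x. f x + f' x) \<in> range (poly_eval d)"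
  by (force simp: poly_eval_add)

lemma range_poly_eval_scale:
  "f \<in> range (poly_eval d) \<Longrightarrow> (\<lambda>x. k * f x) \<in> range (poly_eval d)"
  by (force simp: poly_eval_scale)

lemma range_poly_eval_monomial:
  assumes "\<alpha> \<in> multi_indices d"
  shows "(\<lambda>x. \<Prod>i\<in>UNIV. (x $ i) ^ \<alpha> i) \<in> range (poly_eval d)"
proof
  show "(\<lambda>x. \<Prod>i\<in>UNIV. (x $ i) ^ \<alpha> i) = poly_eval d (\<lambda>\<beta>. if \<beta> = \<alpha> then 1 else 0)"
    using assms
    by (intro ext) (simp add: poly_eval_def finite_multi_indices if_distrib[of "\<lambda>t. t * _"] cong: if_cong)
qed simp

lemma range_poly_eval_const: "(\<lambda>x. k) \<in> range (poly_eval d)"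
  using range_poly_eval_scale[OF range_poly_eval_monomial[of "\<lambda>_. 0" d], of k]
  by (simp add: multi_indices_def)

lemma range_poly_eval_component: "(\<lambda>x. x $ j) \<in> range (poly_eval 1)"
proof -
  let ?e = "\<lambda>i. if i = j then 1 else 0 :: nat"
  have "(\<Prod>i\<in>UNIV. (x $ i) ^ ?e i) = x $ j" for x :: "real ^ 'a"
    by (simp add: if_distrib[of "\<lambda>t. _ ^ t"] cong: if_cong)
  moreover have "?e \<in> multi_indices 1"
    by (simp add: multi_indices_def)
  ultimately show ?thesis
    using range_poly_eval_monomial[of ?e 1] by simp
qed

lemma range_poly_eval_sum:
  assumes "\<And>s. s \<in> S \<Longrightarrow> f s \<in> range (poly_eval d)"
  shows "(\<lambda>x. \<Sum>s\<in>S. f s x) \<in> range (poly_eval d)"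
  using assms
  by (induction S rule: infinite_finite_induct)
    (simp_all add: range_poly_eval_const range_poly_eval_add)

lemma range_poly_eval_mult:
  assumes "f \<in> range (poly_eval a)" "f' \<in> range (poly_eval b)"
  shows "(\<lambda>x. f x * f' x) \<in> range (poly_eval (a + b))"
proof -
  obtain c c' where f: "f = poly_eval a c" and f': "f' = poly_eval b c'"
    using assms by blast
  have "f x * f' x = (\<Sum>\<alpha>\<in>multi_indices a. \<Sum>\<beta>\<in>multi_indices b.
      (c \<alpha> * c' \<beta>) * (\<Prod>i\<in>UNIV. (x $ i) ^ (\<alpha> i + \<beta> i)))" for x
    unfolding f f' poly_eval_def sum_product power_add prod.distrib by (simp only: ac_simps)
  moreover have "(\<lambda>x. \<Sum>\<alpha>\<in>multi_indices a. \<Sum>\<beta>\<in>multi_indices b.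
      (c \<alpha> * c' \<beta>) * (\<Prod>i\<in>UNIV. (x $ i) ^ (\<alpha> i + \<beta> i))) \<in> range (poly_eval (a + b))"
    by (intro range_poly_eval_sum range_poly_eval_scale range_poly_eval_monomial)
      (auto simp: multi_indices_def sum.distrib)
  ultimately show ?thesis by simp
qed

lemma range_poly_eval_power:
  "f \<in> range (poly_eval 1) \<Longrightarrow> (\<lambda>x. f x ^ k) \<in> range (poly_eval k)"
proof (induction k)
  case (Suc k)
  then show ?case using range_poly_eval_mult[of f 1 "\<lambda>x. f x ^ k" k] by simp
qed (simp add: range_poly_eval_const)

lemma range_poly_eval_prod:
  assumes "\<And>i. i \<in> S \<Longrightarrow> f i \<in> range (poly_eval (k i))"
  shows "(\<lambda>x. \<Prod>i\<in>S. f i x) \<in> range (poly_eval (\<Sum>i\<in>S. k i))"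
  using assms
  by (induction S rule: infinite_finite_induct)
    (simp_all add: range_poly_eval_const range_poly_eval_mult)

text \<open>Each coordinate of the affine map has degree at most 1, so substitution turns the
  monomial of a multi-index \<alpha> into a product whose degree is at most the sum of
  \<alpha>.\<close>

lemma range_poly_eval_affine:
  fixes A :: "real ^ 'n ^ 'm" and b :: "real ^ 'm"
  shows "(\<lambda>x. poly_eval d c (A *v x + b)) \<in> range (poly_eval d)"
proof -
  have comp: "(\<lambda>x. (A *v x + b) $ i) \<in> range (poly_eval 1)" for i
    unfolding vector_add_component matrix_vector_mult_def vec_lambda_beta
    by (intro range_poly_eval_add range_poly_eval_sum range_poly_eval_scale
        range_poly_eval_component range_poly_eval_const)
  have "(\<lambda>x. \<Prod>i\<in>UNIV. ((A *v x + b) $ i) ^ \<alpha> i) \<in> range (poly_eval d)"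
    if "\<alpha> \<in> multi_indices d" for \<alpha>
  proof -
    have "(\<lambda>x. \<Prod>i\<in>UNIV. ((A *v x + b) $ i) ^ \<alpha> i) \<in> range (poly_eval (\<Sum>i\<in>UNIV. \<alpha> i))"
      by (intro range_poly_eval_prod range_poly_eval_power comp)
    \<comment> \<open>The factor 1, regarded as a polynomial of degree at most \<open>d\<close>
      minus the sum of \<alpha>, raises the degree bound to exactly \<open>d\<close>.\<close>
    then have "(\<lambda>x. (\<Prod>i\<in>UNIV. ((A *v x + b) $ i) ^ \<alpha> i) * 1)
        \<in> range (poly_eval ((\<Sum>i\<in>UNIV. \<alpha> i) + (d - (\<Sum>i\<in>UNIV. \<alpha> i))))"
      by (rule range_poly_eval_mult[OF _ range_poly_eval_const])
    then show ?thesis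
      using that by (simp add: multi_indices_def)
  qed
  then show ?thesis
    unfolding poly_eval_def[of d c] by (intro range_poly_eval_sum range_poly_eval_scale)
qed

section \<open>The space of polynomials on \<Omega>: linear structure, finite dimension,
  integrability\<close>

lemma poly_space_eq: "poly_space d \<Omega> = (\<lambda>f x. if x \<in> \<Omega> then f x else 0) ` range (poly_eval d)"
  by (auto simp: poly_space_def)

lemma poly_spaceI:
  "f \<in> range (poly_eval d) \<Longrightarrow> (\<lambda>x. if x \<in> \<Omega> then f x else 0) \<in> poly_space d \<Omega>"
  unfolding poly_space_eq by (rule imageI)

lemma subspace_poly_space: "fun_vs.subspace (poly_space d \<Omega>)"
proof (rule fun_vs.subspaceI)
  show "0 \<in> poly_space d \<Omega>"
    unfolding poly_space_eq by (rule image_eqI[OF _ range_poly_eval_const[of 0]]) auto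
next
  fix p q assume "p \<in> poly_space d \<Omega>" "q \<in> poly_space d \<Omega>"
  then obtain f f' where "f \<in> range (poly_eval d)" "p = (\<lambda>x. if x \<in> \<Omega> then f x else 0)"
    "f' \<in> range (poly_eval d)" "q = (\<lambda>x. if x \<in> \<Omega> then f' x else 0)"
    unfolding poly_space_eq by blast
  then show "p + q \<in> poly_space d \<Omega>"
    unfolding poly_space_eq by (intro image_eqI[OF _ range_poly_eval_add[of f d f']]) auto
next
  fix k p assume "p \<in> poly_space d \<Omega>"
  then obtain f where "f \<in> range (poly_eval d)" "p = (\<lambda>x. if x \<in> \<Omega> then f x else 0)"
    unfolding poly_space_eq by blast
  then show "fun_scale k p \<in> poly_space d \<Omega>"
    unfolding poly_space_eq by (intro image_eqI[OF _ range_poly_eval_scale[of f d k]])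
      (auto simp: fun_scale_def)
qed

lemma sum_apply: "(\<Sum>s\<in>S. f s) x = (\<Sum>s\<in>S. f s x)"
  by (induction S rule: infinite_finite_induct) simp_all

text \<open>Provides the finite spanning set that makes \<open>poly_space\<close>
  finite-dimensional.\<close>

lemma poly_space_subset_span:
  "poly_space d \<Omega> \<subseteq> fun_vs.span
    ((\<lambda>\<alpha> x. if x \<in> \<Omega> then \<Prod>i\<in>UNIV. (x $ i) ^ \<alpha> i else 0) ` multi_indices d)"
    (is "_ \<subseteq> fun_vs.span (?m ` _)")
proof
  fix p assume "p \<in> poly_space d \<Omega>"
  then obtain c where p: "p = (\<lambda>x. if x \<in> \<Omega> then poly_eval d c x else 0)"
    by (auto simp: poly_space_def)
  have "p = (\<Sum>\<alpha>\<in>multi_indices d. fun_scale (c \<alpha>) (?m \<alpha>))"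
    by (auto simp: p fun_eq_iff sum_apply fun_scale_def poly_eval_def)
  also have "\<dots> \<in> fun_vs.span (?m ` multi_indices d)"
    by (intro fun_vs.span_sum fun_vs.span_scale fun_vs.span_base imageI)
  finally show "p \<in> fun_vs.span (?m ` multi_indices d)" .
qed

lemma continuous_on_poly_space:
  assumes "p \<in> poly_space d \<Omega>" "C \<subseteq> \<Omega>"
  shows "continuous_on C p"
proof -
  obtain c where p: "p = (\<lambda>x. if x \<in> \<Omega> then poly_eval d c x else 0)"
    using assms by (auto simp: poly_space_def)
  have "continuous_on C p \<longleftrightarrow> continuous_on C (poly_eval d c)"
    using assms(2) by (intro continuous_on_cong) (auto simp: p)
  then show ?thesis by (simp add: continuous_on_poly_eval)
qed

lemma set_integrable_poly_space:
  assumes "p \<in> poly_space d \<Omega>" "compact C" "C \<subseteq> \<Omega>"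
  shows "set_integrable lebesgue C p"
  using borel_integrable_compact[OF assms(2) continuous_on_poly_space[OF assms(1,3)]]
  by (simp add: set_integrable_def integrable_completion borel_measurable_integrable)

section \<open>Lagrange bases\<close>

context vector_space
begin

text \<open>An element of \<open>span B\<close> outside \<open>span T\<close> could be added to
  \<open>T\<close>, giving an independent set in \<open>span B\<close> with more than
  \<open>card B\<close> elements.\<close>

lemma span_subset_span_if_card_ge:
  assumes "finite B" "independent T" "T \<subseteq> span B" "card B \<le> card T"
  shows "span B \<subseteq> span T"
proof
  fix x assume x: "x \<in> span B"
  have T: "finite T"
    using independent_span_bound[OF assms(1-3)] by simp
  show "x \<in> span T"
  proof (rule ccontr)
    assume "x \<notin> span T"
    then have "independent (insert x T)" and "x \<notin> T"
      using assms(2) by (auto simp: independent_insertI span_base)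
    then have "card (insert x T) \<le> card B"
      using independent_span_bound[OF assms(1), of "insert x T"] assms(3) x by auto
    then show False
      using \<open>x \<notin> T\<close> T assms(4) by simp
  qed
qed

end

text \<open>The map sending p to the family of values \<open>L i p\<close> is linear and injective
  on \<open>P\<close>, and the dimensions agree, so every unit vector is attained. Preimages of the
  unit vectors form the dual basis.\<close>

lemma dual_basis_exists:
  fixes L :: "'i \<Rightarrow> ('a \<Rightarrow> real) \<Rightarrow> real"
  assumes P: "fun_vs.subspace P" "P \<subseteq> fun_vs.span S" "finite S"
    and I: "finite I" "card I = fun_vs.dim P"
    and add: "\<And>i p q. i \<in> I \<Longrightarrow> p \<in> P \<Longrightarrow> q \<in> P \<Longrightarrow> L i (p + q) = L i p + L i q"
    and scale: "\<And>i k p. i \<in> I \<Longrightarrow> p \<in> P \<Longrightarrow> L i (fun_scale k p) = k * L i p"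
    and inj: "\<And>p. p \<in> P \<Longrightarrow> (\<And>i. i \<in> I \<Longrightarrow> L i p = 0) \<Longrightarrow> p = 0"
  obtains l where "inj_on l I" "fun_vs.independent (l ` I)" "fun_vs.span (l ` I) = P"
    "\<And>i j. i \<in> I \<Longrightarrow> j \<in> I \<Longrightarrow> L i (l j) = (if i = j then 1 else 0)"
proof -
  interpret vector_space_pair
    "fun_scale :: real \<Rightarrow> ('a \<Rightarrow> real) \<Rightarrow> 'a \<Rightarrow> real" "fun_scale :: real \<Rightarrow> ('i \<Rightarrow> real) \<Rightarrow> 'i \<Rightarrow> real"
    by unfold_locales
  obtain B where B: "B \<subseteq> P" "fun_vs.independent B" "P \<subseteq> fun_vs.span B" "card B = fun_vs.dim P"
    using fun_vs.basis_exists by blast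
  have fin_B: "finite B"
    using fun_vs.independent_span_bound[OF P(3) B(2)] B(1) P(2) by blast
  have span_B: "fun_vs.span B = P"
    using B(1,3) P(1) fun_vs.span_minimal by blast
  define v where "v p = (\<lambda>i. if i \<in> I then L i p else 0)" for p
  \<comment> \<open>The functionals are assumed linear only on \<open>P\<close>. Extending
    \<open>v\<close> linearly from the basis \<open>B\<close> gives a map that is linear on all
    functions and agrees with \<open>v\<close> on \<open>P\<close>.\<close>
  obtain g where g: "Vector_Spaces.linear fun_scale fun_scale g" "\<forall>x\<in>B. g x = v x"
    using linear_independent_extend[OF B(2)] by blast
  interpret g: Vector_Spaces.linear
    "fun_scale :: real \<Rightarrow> ('a \<Rightarrow> real) \<Rightarrow> 'a \<Rightarrow> real" "fun_scale :: real \<Rightarrow> ('i \<Rightarrow> real) \<Rightarrow> 'i \<Rightarrow> real" g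
    by (rule g(1))
  have g_eq: "g p = v p" if "p \<in> P" for p
  proof -
    have "fun_vs.subspace {p \<in> P. g p = v p}"
    proof (rule fun_vs.subspaceI)
      have "L i 0 = 0" if "i \<in> I" for i
        using scale[OF that fun_vs.subspace_0[OF P(1)], of 0] by simp
      then show "0 \<in> {p \<in> P. g p = v p}"
        using fun_vs.subspace_0[OF P(1)] by (auto simp: g.zero v_def)
    next
      fix p q assume "p \<in> {p \<in> P. g p = v p}" "q \<in> {p \<in> P. g p = v p}"
      then show "p + q \<in> {p \<in> P. g p = v p}"
        using fun_vs.subspace_add[OF P(1)] by (auto simp: g.add v_def add)
    next
      fix k p assume "p \<in> {p \<in> P. g p = v p}"
      then show "fun_scale k p \<in> {p \<in> P. g p = v p}"
        using fun_vs.subspace_scale[OF P(1)] scale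
        by (auto simp: g.scale v_def fun_scale_def[where 'a = 'i])
    qed
    then have "fun_vs.span B \<subseteq> {p \<in> P. g p = v p}"
      using B(1) g(2) by (intro fun_vs.span_minimal) auto
    then show ?thesis using that span_B by auto
  qed
  have inj_g: "inj_on g P"
    unfolding g.inj_on_iff_eq_0[OF P(1)]
  proof (intro ballI impI)
    fix p assume p: "p \<in> P" "g p = 0"
    then have "L i p = 0" if "i \<in> I" for i
      using that fun_cong[OF g_eq[OF p(1)], of i] by (simp add: v_def)
    with p(1) show "p = 0" by (rule inj)
  qed
  define e where "e i = (indicator {i} :: 'i \<Rightarrow> real)" for i
  have scale_e: "fun_scale k (e i) j = (if i = j then k else 0)" for k i j
    by (simp add: fun_scale_def e_def indicator_def)
  have e_span: "w \<in> fun_vs.span (e ` I)" if "\<And>i. i \<notin> I \<Longrightarrow> w i = 0" for w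
  proof -
    have "w = (\<Sum>i\<in>I. fun_scale (w i) (e i))"
    proof
      fix j
      have "(\<Sum>i\<in>I. fun_scale (w i) (e i)) j = (\<Sum>i\<in>I. fun_scale (w i) (e i) j)"
        by (induction I rule: infinite_finite_induct) simp_all
      also have "\<dots> = w j"
        using that[of j] I(1) by (auto simp: scale_e)
      finally show "w j = (\<Sum>i\<in>I. fun_scale (w i) (e i)) j" by simp
    qed
    also have "\<dots> \<in> fun_vs.span (e ` I)"
      by (intro fun_vs.span_sum fun_vs.span_scale fun_vs.span_base imageI)
    finally show ?thesis .
  qed
  \<comment> \<open>By injectivity the images of the basis \<open>B\<close> are independent, and
    there are \<open>card I\<close> of them, enough to span everything the unit vectors
    span.\<close>
  have "fun_vs.span (e ` I) \<subseteq> fun_vs.span (g ` B)"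
  proof (rule fun_vs.span_subset_span_if_card_ge)
    show "fun_vs.independent (g ` B)"
      using B(2) inj_g by (intro g.independent_injective_image) (simp_all add: span_B)
    show "g ` B \<subseteq> fun_vs.span (e ` I)"
      using g(2) by (auto intro!: e_span simp: v_def)
    have "card (g ` B) = card I"
      using inj_on_subset[OF inj_g B(1)] B(4) I(2) by (simp add: card_image)
    then show "card (e ` I) \<le> card (g ` B)"
      using card_image_le[OF I(1)] by simp
  qed (use I in simp)
  then have "fun_vs.span (e ` I) \<subseteq> g ` P"
    by (simp add: g.span_image span_B)
  then have "e j \<in> g ` P" if "j \<in> I" for j
    using that fun_vs.span_base[of "e j" "e ` I"] by blast
  then have "\<forall>j\<in>I. \<exists>p. p \<in> P \<and> g p = e j"
    by (simp add: image_iff) metis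
  from bchoice[OF this] obtain l where l: "l j \<in> P" "g (l j) = e j" if "j \<in> I" for j
    by blast
  have dual: "L i (l j) = (if i = j then 1 else 0)" if "i \<in> I" "j \<in> I" for i j
  proof -
    have "L i (l j) = v (l j) i" using that by (simp add: v_def)
    also have "\<dots> = e j i" using l[OF that(2)] by (simp flip: g_eq)
    finally show ?thesis by (auto simp: e_def)
  qed
  have inj_l: "inj_on l I"
    by (rule inj_onI) (metis dual zero_neq_one)
  have indep: "fun_vs.independent (l ` I)"
  proof (rule fun_vs.independent_if_scalars_zero)
    fix f x assume sum: "(\<Sum>x\<in>l ` I. fun_scale (f x) x) = 0" and "x \<in> l ` I"
    then obtain j where j: "j \<in> I" "x = l j" by blast
    \<comment> \<open>Applying \<open>g\<close> to a vanishing combination and reading off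
      coordinate \<open>j\<close> isolates the coefficient of \<open>l j\<close>.\<close>
    have "0 = g (\<Sum>x\<in>l ` I. fun_scale (f x) x) j" by (simp add: sum g.zero)
    also have "\<dots> = (\<Sum>i\<in>I. fun_scale (f (l i)) (e i)) j"
      using l by (simp add: g.sum g.scale sum.reindex[OF inj_l])
    also have "\<dots> = (\<Sum>i\<in>I. fun_scale (f (l i)) (e i) j)"
      by (induction I rule: infinite_finite_induct) simp_all
    also have "\<dots> = f (l j)"
      using j I(1) by (simp add: scale_e)
    finally show "f x = 0" using j by simp
  qed (use I in simp)
  have "fun_vs.span B \<subseteq> fun_vs.span (l ` I)"
    using indep l(1) B(4) I(2) fin_B
    by (intro fun_vs.span_subset_span_if_card_ge) (auto simp: span_B card_image inj_l)
  moreover have "fun_vs.span (l ` I) \<subseteq> P"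
    using l(1) P(1) by (intro fun_vs.span_minimal) auto
  ultimately have "fun_vs.span (l ` I) = P" by (simp add: span_B)
  from that[OF inj_l indep this dual] show thesis .
qed

lemma lagrange_basis_in_poly_space:
  assumes "is_lagrange_basis d \<Omega> N K l" "j \<in> {1..N}"
  shows "l j \<in> poly_space d \<Omega>"
  using assms fun_vs.span_base[of "l j" "l ` {1..N}"] by (auto simp: is_lagrange_basis_def)

text \<open>Evaluates the definite description. Two Lagrange bases differ at each index by a
  polynomial with vanishing integrals over all \<open>K i\<close>, which is 0 by unisolvence;
  extensionality settles the other indices.\<close>

lemma lagrange_basis_eqI:
  assumes K: "\<And>i. i \<in> {1..N} \<Longrightarrow> compact (K i) \<and> K i \<subseteq> \<Omega>"
    and uni: "unisolvent d \<Omega> N K"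
    and l: "is_lagrange_basis d \<Omega> N K l" "l \<in> extensional {1..N}"
  shows "lagrange_basis d \<Omega> N K = l"
  unfolding lagrange_basis_def
proof (rule the_equality)
  fix l' assume l': "l' \<in> extensional {1..N} \<and> is_lagrange_basis d \<Omega> N K l'"
  show "l' = l"
  proof (rule extensionalityI[of _ "{1..N}"])
    fix j assume j: "j \<in> {1..N}"
    have mem: "l j \<in> poly_space d \<Omega>" "l' j \<in> poly_space d \<Omega>"
      using l l' j lagrange_basis_in_poly_space by blast+
    have "(LINT x:K i|lebesgue. (l' j - l j) x) = 0" if i: "i \<in> {1..N}" for i
      using l l' i j K[OF i] mem[THEN set_integrable_poly_space, of "K i"]
      by (simp add: set_integral_diff is_lagrange_basis_def)
    moreover have "l' j - l j \<in> poly_space d \<Omega>"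
      using mem subspace_poly_space fun_vs.subspace_diff by blast
    ultimately have "l' j - l j = 0"
      using uni unfolding unisolvent_def by blast
    then show "l' j = l j" by simp
  qed (use l l' in auto)
qed (use l in blast)

text \<open>The dual basis to the functionals of integration over \<open>K i\<close>; unisolvence is
  exactly their joint injectivity.\<close>

lemma ex_lagrange_basis:
  fixes \<Omega> :: "(real ^ 'n) set"
  assumes K: "\<And>i. i \<in> {1..N} \<Longrightarrow> compact (K i) \<and> K i \<subseteq> \<Omega>"
    and uni: "unisolvent d \<Omega> N K" and N: "N = fun_vs.dim (poly_space d \<Omega>)"
  obtains l where "is_lagrange_basis d \<Omega> N K l" "l \<in> extensional {1..N}"
proof -
  obtain l where l: "inj_on l {1..N}" "fun_vs.independent (l ` {1..N})"
    "fun_vs.span (l ` {1..N}) = poly_space d \<Omega>"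
    "\<And>i j. i \<in> {1..N} \<Longrightarrow> j \<in> {1..N} \<Longrightarrow> (LINT x:K i|lebesgue. l j x) = (if i = j then 1 else 0)"
  proof (rule dual_basis_exists[OF subspace_poly_space poly_space_subset_span,
        where I = "{1..N}" and L = "\<lambda>i p. LINT x:K i|lebesgue. p x"])
    show "(LINT x:K i|lebesgue. (p + q) x) = (LINT x:K i|lebesgue. p x) + (LINT x:K i|lebesgue. q x)"
      if "i \<in> {1..N}" "p \<in> poly_space d \<Omega>" "q \<in> poly_space d \<Omega>" for i p q
      using that(2,3)[THEN set_integrable_poly_space, of "K i"] K[OF that(1)]
      by (simp add: set_integral_add)
    show "(LINT x:K i|lebesgue. fun_scale k p x) = k * (LINT x:K i|lebesgue. p x)" for i k p
      by (simp add: fun_scale_def)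
    show "p = 0" if "p \<in> poly_space d \<Omega>" "\<And>i. i \<in> {1..N} \<Longrightarrow> (LINT x:K i|lebesgue. p x) = 0" for p
      using that uni by (simp add: unisolvent_def)
  qed (use N finite_multi_indices in auto)
  then have "is_lagrange_basis d \<Omega> N K (restrict l {1..N})"
    by (simp add: is_lagrange_basis_def)
  then show thesis by (rule that) simp
qed

section \<open>Invariance of the Lebesgue constant\<close>

text \<open>\<open>K'\<close> is prescribed only on \<open>{1..N}\<close> because \<phi> is known to
  be affine only on \<Omega>, and \<open>K i\<close> is known to lie in \<Omega> only for these
  indices.\<close>

lemma lebesgue_constant_affine_image:
  fixes \<Omega> :: "(real ^ 'n) set" and A A' :: "real ^ 'n ^ 'n" and b :: "real ^ 'n"
  defines "g \<equiv> \<lambda>x. A *v x + b"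
  assumes AA': "A ** A' = mat 1"
    and N: "N = fun_vs.dim (poly_space d \<Omega>)"
    and K: "\<And>i. i \<in> {1..N} \<Longrightarrow> compact_body (K i) \<and> K i \<subseteq> \<Omega>"
    and K': "\<And>i. i \<in> {1..N} \<Longrightarrow> K' i = g ` K i"
    and uni: "unisolvent d \<Omega> N K"
  shows "lebesgue_constant d (g ` \<Omega>) N K' = lebesgue_constant d \<Omega> N K"
proof -
  define h where "h = (\<lambda>y. A' *v y + - (A' *v b))"
  have A'A: "A' ** A = mat 1" using AA' by (simp add: matrix_left_right_inverse)
  have hg: "h (g x) = x" and gh: "g (h x) = x" for x
    by (simp_all add: g_def h_def matrix_vector_right_distrib matrix_vector_mult_diff_distrib
        matrix_vector_mul_assoc A'A AA')
  have cont_g: "continuous_on S g" for S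
    unfolding g_def by (intro continuous_intros)
  have body_compact: "compact C" if "compact_body C" for C :: "(real ^ 'n) set"
    using that by (simp add: compact_body_def)
  obtain c where c: "0 < c"
    and measure_c: "\<And>C. C \<in> sets borel \<Longrightarrow> emeasure lebesgue (g ` C) = ennreal c * emeasure lebesgue C"
    and integral_c: "\<And>C f. compact C \<Longrightarrow> continuous_on C (\<lambda>x. f (g x)) \<Longrightarrow>
      (LINT y:g ` C|lebesgue. f y) = c * (LINT x:C|lebesgue. f (g x))"
    unfolding g_def by (rule affine_change_of_variables[OF AA', of b]) blast
  \<comment> \<open>Dividing by \<open>c\<close> offsets the factor in the change of variables. The
    cutoff keeps the convention that functions vanish outside their domain, and \<open>T\<close> is
    linear on all functions.\<close>
  define T where "T f = (\<lambda>y. if y \<in> g ` \<Omega> then f (h y) / c else 0)" for f :: "real ^ 'n \<Rightarrow> real"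
  have T_g: "T f (g x) = f x / c" if "x \<in> \<Omega>" for f x
    using that by (simp add: T_def hg)
  interpret vector_space_pair
    "fun_scale :: real \<Rightarrow> (real ^ 'n \<Rightarrow> real) \<Rightarrow> _" "fun_scale :: real \<Rightarrow> (real ^ 'n \<Rightarrow> real) \<Rightarrow> _"
    by unfold_locales
  interpret T: Vector_Spaces.linear
    "fun_scale :: real \<Rightarrow> (real ^ 'n \<Rightarrow> real) \<Rightarrow> _" "fun_scale :: real \<Rightarrow> (real ^ 'n \<Rightarrow> real) \<Rightarrow> _" T
    by unfold_locales (auto simp: T_def fun_scale_def fun_eq_iff add_divide_distrib)
  \<comment> \<open>\<open>T\<close> sees only the values on \<Omega>; members of
    \<open>poly_space\<close> are 0 elsewhere.\<close>
  have inj_T: "inj_on T (poly_space d \<Omega>)"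
    unfolding T.inj_on_iff_eq_0[OF subspace_poly_space]
  proof (intro ballI impI ext)
    fix p x assume "p \<in> poly_space d \<Omega>" "T p = 0"
    then show "p x = 0 x"
      using T_g[of x p] c by (cases "x \<in> \<Omega>") (auto simp: poly_space_def)
  qed
  have T_image: "T ` poly_space d \<Omega> = poly_space d (g ` \<Omega>)"
  proof safe
    fix p assume "p \<in> poly_space d \<Omega>"
    then obtain a where p: "p = (\<lambda>x. if x \<in> \<Omega> then poly_eval d a x else 0)"
      by (auto simp: poly_space_def)
    have "(\<lambda>y. if y \<in> g ` \<Omega> then inverse c * poly_eval d a (h y) else 0) \<in> poly_space d (g ` \<Omega>)"
      unfolding h_def by (intro poly_spaceI range_poly_eval_scale range_poly_eval_affine)
    moreover have "T p = (\<lambda>y. if y \<in> g ` \<Omega> then inverse c * poly_eval d a (h y) else 0)"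
      by (rule ext) (auto simp: T_def p hg divide_inverse)
    ultimately show "T p \<in> poly_space d (g ` \<Omega>)" by simp
  next
    fix q assume "q \<in> poly_space d (g ` \<Omega>)"
    then obtain a where q: "q = (\<lambda>x. if x \<in> g ` \<Omega> then poly_eval d a x else 0)"
      by (auto simp: poly_space_def)
    \<comment> \<open>Composition with \<open>g\<close> and the factor \<open>c\<close> undo
      \<open>T\<close>.\<close>
    define p where "p = (\<lambda>x. if x \<in> \<Omega> then c * poly_eval d a (g x) else 0)"
    have "p \<in> poly_space d \<Omega>"
      unfolding p_def g_def by (intro poly_spaceI range_poly_eval_scale range_poly_eval_affine)
    moreover have "q = T p"
      using c by (intro ext) (auto simp: T_def p_def q hg)
    ultimately show "q \<in> T ` poly_space d \<Omega>" by blast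
  qed
  have integral_T: "(LINT y:g ` C|lebesgue. T p y) = (LINT x:C|lebesgue. p x)"
    if p: "p \<in> poly_space d \<Omega>" and C: "compact C" "C \<subseteq> \<Omega>" for p C
  proof -
    have eq: "T p (g x) = p x / c" if "x \<in> C" for x
      using that C(2) T_g by blast
    have "continuous_on C (\<lambda>x. p x / c)"
      using c continuous_on_poly_space[OF p C(2)] by (intro continuous_intros) auto
    then have "continuous_on C (\<lambda>x. T p (g x))"
      using eq by (simp cong: continuous_on_cong)
    then have "(LINT y:g ` C|lebesgue. T p y) = c * (LINT x:C|lebesgue. T p (g x))"
      by (rule integral_c[OF C(1)])
    also have "(LINT x:C|lebesgue. T p (g x)) = (LINT x:C|lebesgue. p x / c)"
      using eq borel_compact[OF C(1)] by (intro set_lebesgue_integral_cong) auto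
    finally show ?thesis using c by simp
  qed
  have Kc: "compact (K i) \<and> K i \<subseteq> \<Omega>" if "i \<in> {1..N}" for i
    using K[OF that] body_compact by blast
  have K'c: "compact (K' i) \<and> K' i \<subseteq> g ` \<Omega>" if "i \<in> {1..N}" for i
    using Kc[OF that] by (auto simp: K'[OF that] intro!: compact_continuous_image cont_g)
  have uni': "unisolvent d (g ` \<Omega>) N K'"
    unfolding unisolvent_def
  proof (intro ballI impI)
    fix q assume q: "q \<in> poly_space d (g ` \<Omega>)" "\<forall>i\<in>{1..N}. (LINT x:K' i|lebesgue. q x) = 0"
    then obtain p where p: "p \<in> poly_space d \<Omega>" "q = T p"
      using T_image by blast
    have "\<forall>i\<in>{1..N}. (LINT x:K i|lebesgue. p x) = 0"
      using q(2) Kc p integral_T by (simp add: K')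
    then have "p = 0" using uni p(1) by (simp add: unisolvent_def)
    then show "q = 0" by (simp add: p(2) T.zero)
  qed
  obtain l where l: "is_lagrange_basis d \<Omega> N K l" "l \<in> extensional {1..N}"
    using ex_lagrange_basis[OF Kc uni N] by blast
  \<comment> \<open>The restriction makes the transported family extensional, as
    \<open>lagrange_basis_eqI\<close> requires.\<close>
  define l' where "l' = restrict (T \<circ> l) {1..N}"
  have l_mem: "l j \<in> poly_space d \<Omega>" if "j \<in> {1..N}" for j
    using l(1) that by (rule lagrange_basis_in_poly_space)
  have "is_lagrange_basis d (g ` \<Omega>) N K' l'"
  proof -
    have im: "l' ` {1..N} = T ` l ` {1..N}" by (auto simp: l'_def)
    have span: "fun_vs.span (l ` {1..N}) = poly_space d \<Omega>"
      using l(1) by (simp add: is_lagrange_basis_def)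
    have "l ` {1..N} \<subseteq> poly_space d \<Omega>" using l_mem by blast
    then have "inj_on (T \<circ> l) {1..N}"
      using l(1) inj_on_subset[OF inj_T] by (simp add: comp_inj_on is_lagrange_basis_def)
    then have "inj_on l' {1..N}" by (simp add: l'_def)
    moreover have "fun_vs.independent (l' ` {1..N})"
      unfolding im using l(1) inj_T
      by (intro T.independent_injective_image) (simp_all add: is_lagrange_basis_def)
    moreover have "fun_vs.span (l' ` {1..N}) = poly_space d (g ` \<Omega>)"
      unfolding im by (simp only: T.span_image span T_image)
    moreover have "(LINT x:K' i|lebesgue. l' j x) = (if i = j then 1 else 0)"
      if "i \<in> {1..N}" "j \<in> {1..N}" for i j
      using that l(1) integral_T[OF l_mem[OF that(2)], of "K i"] Kc[OF that(1)]
      by (simp add: K' l'_def is_lagrange_basis_def)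
    ultimately show ?thesis by (simp add: is_lagrange_basis_def)
  qed
  then have basis': "lagrange_basis d (g ` \<Omega>) N K' = l'"
    by (intro lagrange_basis_eqI K'c uni') (simp_all add: l'_def)
  have basis: "lagrange_basis d \<Omega> N K = l"
    by (intro lagrange_basis_eqI Kc uni l)
  have measure_g: "measure lebesgue (g ` C) = c * measure lebesgue C" if "compact C" for C
    using measure_c[OF borel_compact[OF that]] c by (simp add: measure_def enn2real_mult)
  have value_eq: "1 / measure lebesgue (g ` C) *
        (\<Sum>i=1..N. measure lebesgue (K' i) * \<bar>LINT x:g ` C|lebesgue. l' i x\<bar>) =
      1 / measure lebesgue C * (\<Sum>i=1..N. measure lebesgue (K i) * \<bar>LINT x:C|lebesgue. l i x\<bar>)"
    if C: "compact_body C" "C \<subseteq> \<Omega>" for C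
  proof -
    \<comment> \<open>The integrals are unchanged and each \<open>K' i\<close> contributes one
      factor \<open>c\<close>, which cancels against the measure of the image of
      \<open>C\<close>.\<close>
    have "(\<Sum>i=1..N. measure lebesgue (K' i) * \<bar>LINT x:g ` C|lebesgue. l' i x\<bar>)
        = (\<Sum>i=1..N. c * (measure lebesgue (K i) * \<bar>LINT x:C|lebesgue. l i x\<bar>))"
      using Kc l_mem integral_T[OF _ body_compact[OF C(1)] C(2)]
      by (intro sum.cong) (simp_all add: K' l'_def measure_g)
    then show ?thesis
      using c by (simp add: measure_g[OF body_compact[OF C(1)]] flip: sum_distrib_left)
  qed
  \<comment> \<open>Both \<open>g\<close> and its inverse preserve compact bodies, so the suprema
    run over sets matched by \<open>g\<close> and can be compared term by term.\<close>
  have bodies: "{C. compact_body C \<and> C \<subseteq> g ` \<Omega>} = (`) g ` {C. compact_body C \<and> C \<subseteq> \<Omega>}"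
  proof safe
    fix C assume C: "compact_body C" "C \<subseteq> g ` \<Omega>"
    have "compact_body (h ` C)"
      unfolding h_def by (rule compact_body_affine_image[OF A'A C(1)])
    moreover have "h ` C \<subseteq> \<Omega>" using C(2) by (auto simp: hg)
    moreover have "C = g ` h ` C" by (simp add: image_image gh)
    ultimately show "C \<in> (`) g ` {C. compact_body C \<and> C \<subseteq> \<Omega>}" by blast
  next
    fix C :: "(real ^ 'n) set" assume "compact_body C"
    then show "compact_body (g ` C)"
      unfolding g_def by (rule compact_body_affine_image[OF AA'])
  qed auto
  show ?thesis
    unfolding lebesgue_constant_def basis basis' bodies image_image
    by (intro SUP_cong refl arg_cong[of _ _ ereal] value_eq) simp_all
qed

theorem proposition2p6:
  fixes \<Omega> :: "(real ^ 'n) set"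
    and d N :: nat
    and K :: "nat \<Rightarrow> (real ^ 'n) set"
    and \<phi> :: "real ^ 'n \<Rightarrow> real ^ 'n"
    and A :: "real ^ 'n ^ 'n"
    and b :: "real ^ 'n"
  assumes "open \<Omega>" and "connected \<Omega>" and "\<Omega> \<noteq> {}"
    and "N = fun_vs.dim (poly_space d \<Omega>)"
    and "\<And>i. i \<in> {1..N} \<Longrightarrow> compact_body (K i) \<and> K i \<subseteq> \<Omega>"
    and "unisolvent d \<Omega> N K"
    and "\<And>x. x \<in> \<Omega> \<Longrightarrow> \<phi> x = A *v x + b"
    and "det A \<noteq> 0"
  shows "lebesgue_constant d \<Omega> N K = lebesgue_constant d (\<phi> ` \<Omega>) N (\<lambda>i. \<phi> ` K i)"
proof -
  obtain A' where A': "A ** A' = mat 1"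
    using assms(8) invertible_det_nz unfolding invertible_def by blast
  \<comment> \<open>Outside \<Omega> nothing is known about \<phi>, so it is replaced by the affine
    map only on subsets of \<Omega>.\<close>
  have image: "\<phi> ` S = (\<lambda>x. A *v x + b) ` S" if "S \<subseteq> \<Omega>" for S
    using that assms(7) by (intro image_cong) auto
  show ?thesis
    unfolding image[OF subset_refl] using assms(4-6) image
    by (intro lebesgue_constant_affine_image[OF A', symmetric]) auto
qed

end
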